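(* Let $X=[0,1]$ and let $(T,X,\mu)$ be a Gibbs-Markov map. Let $\alpha\in(1,2)$ and let $\phi:X\to\mathbb{R}$ be a measurable function in the domain of attraction of a stable law of index $\alpha$. Suppose there exists a constant $K$ such that $\|\phi\,\mathbf{1}_{\{|\phi|<t\}}\|_{\mathrm{BV}}\le Kt$ for all sufficiently large $t$. Let $(b_n)_{n\ge1}$ be a sequence of positive reals with $\lim_{n\to\infty} n\,\mu(|\phi|>b_n)=1$. Then for every $\delta>0$, $$\lim_{\epsilon\to0}\ \limsup_{n\to\infty}\ \mu\left\{\left|\frac1{b_n}\sum_{j=1}^n \phi\circ T^j\,\mathbf{1}_{\{|\phi\circ T^j|<b_n\epsilon\}}-\frac1{b_n}E\Big[\sum_{j=1}^n \phi\circ T^j\,\mathbf{1}_{\{|\phi\circ T^j|<b_n\epsilon\}}\Big]\right|>\delta\right\}=0 .$$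
   Context: $E[\cdot]$ denotes expectation with respect to $\mu$. $\mathrm{BV}(X)$ is the space of functions of bounded variation on $X=[0,1]$ with its usual norm $\|\cdot\|_{\mathrm{BV}}$ (total variation plus $L^1$ norm). Domain of attraction: $\phi$ is in the domain of attraction of a stable law of index $\alpha$ (equivalently, is regularly varying with index $\alpha$) if $\mu(|\phi|>x)=x^{-\alpha}L(x)$ for a slowly varying function $L$ and $\lim_{x\to\infty}\mu(\phi>x)/\mu(|\phi|>x)=p$ for some $p\in[0,1]$. Gibbs-Markov map: let $m$ be Lebesgue measure on $X=[0,1]$, let $\mu$ be a probability measure equivalent to $m$ with density bounded above and bounded away from zero, and let $\mathcal{P}=\{A_i\}$ be a countable partition of $[0,1]$ (mod $m$) into open intervals with $m(A_i)>0$. An ergodic $\mu$-preserving transformation $T:X\to X$, differentiable on each $A_i$, is a Gibbs-Markov map if: (1) the $\sigma$-algebra $\mathcal{B}$ of $X$ is the smallest $m$-complete $\sigma$-algebra containing $\bigvee_{n\ge0}T^{-n}\mathcal{P}$; (2) (Markov property and big images) for all $A_i\in\mathcal{P}$, $TA_i$ is (mod $m$) a union of elements of $\mathcal{P}$, and there is $C>0$ with $m(TA_i)>C$ for all $i$; (3) $T:A_i\to TA_i$ is invertible for each $i$; (4) there is $\Lambda>1$ such that $|T'(x)|>\Lambda$ for all $x$ where $T'$ is defined; (5) (bounded distortion) there are constants $0<C_1\le C_2$ such that for all $n$, all $A\in\bigvee_{j=0}^nT^{-j}\mathcal{P}$ and all $x,y\in A$, $C_1\le\left|\frac{DT^n(x)}{DT^n(y)}\right|\le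 C_2$. Moreover $T$ has exponential decay in $\mathrm{BV}(X)$: the transfer operator $P:L^1(\mu)\to L^1(\mu)$, defined by $\int f\circ T\cdot g\,d\mu=\int f\cdot P(g)\,d\mu$ for all $f\in L^\infty(\mu)$, $g\in L^1(\mu)$, satisfies, for some $C>0$ and $\lambda\in(0,1)$, $\|P^k g\|_{\mathrm{BV}}\le C\lambda^k\|g\|_{\mathrm{BV}}$ for all $k\ge0$ and all $g\in\mathrm{BV}(X)$ with $\int_X g\,d\mu=0$. *)

theory Defs
  imports "HOL-Probability.Probability"
begin

abbreviation leb01 :: "real measure"
  where "leb01 \<equiv> lebesgue_on {0..1}"

definition total_variation :: "real set \<Rightarrow> (real \<Rightarrow> real) \<Rightarrow> ennreal"
  where "total_variation S f =
    (SUP xs\<in>{xs. sorted xs \<and> set xs \<subseteq> S}.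
       \<Sum>i<length xs - 1. ennreal \<bar>f (xs ! Suc i) - f (xs ! i)\<bar>)"

text \<open>
  Elements of \<open>BV\<close> are classes modulo null sets (the transfer operator below acts on such
  classes), so the variation of a function is the infimum of the pointwise total variations of
  its versions.  The norm takes the value \<open>\<infinity>\<close> outside \<open>BV\<close>.
\<close>

definition BV_norm :: "(real \<Rightarrow> real) \<Rightarrow> ennreal"
  where "BV_norm f =
    (INF g\<in>{g. AE x in leb01. g x = f x}. total_variation {0..1} g)
    + (\<integral>\<^sup>+ x. ennreal \<bar>f x\<bar> \<partial>leb01)"

definition BV :: "(real \<Rightarrow> real) set"
  where "BV = {f \<in> borel_measurable leb01. BV_norm f < \<infinity>}"

definition measure_preserving :: "'a measure \<Rightarrow> ('a \<Rightarrow> 'a) \<Rightarrow> bool"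
  where "measure_preserving M T \<longleftrightarrow> T \<in> M \<rightarrow>\<^sub>M M \<and> distr M M T = M"

definition ergodic :: "'a measure \<Rightarrow> ('a \<Rightarrow> 'a) \<Rightarrow> bool"
  where "ergodic M T \<longleftrightarrow>
    (\<forall>A\<in>sets M. T -` A \<inter> space M = A \<longrightarrow> measure M A = 0 \<or> measure M A = 1)"

definition preimages :: "(real \<Rightarrow> real) \<Rightarrow> real set set \<Rightarrow> real set set"
  where "preimages T P = {(T ^^ n) -` A \<inter> {0..1} | n A. A \<in> P}"

text \<open>The members of the join of the partitions \<open>T\<^sup>-\<^sup>j P\<close> with \<open>j \<le> n\<close>.\<close>

definition cylinders :: "(real \<Rightarrow> real) \<Rightarrow> real set set \<Rightarrow> nat \<Rightarrow> real set set"
  where "cylinders T P n = {\<Inter>j\<in>{..n}. (T ^^ j) -` A j \<inter> {0..1} | A. \<forall>j\<le>n. A j \<in> P}"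

definition complete_sigma_algebra :: "'a measure \<Rightarrow> 'a set set \<Rightarrow> bool"
  where "complete_sigma_algebra M F \<longleftrightarrow>
    sigma_algebra (space M) F \<and> (\<forall>N\<in>F \<inter> null_sets M. Pow N \<subseteq> F)"

text \<open>
  The map is a total function on the reals of which only the restriction to the unit interval
  matters.  The derivative of \<open>T\<close> is taken within the unit interval, so that values outside
  play no role at the end points.  In \<open>bounded_distortion\<close>, the points of a cylinder are interior
  points at which the iterate is differentiable, and \<^const>\<open>deriv\<close> is its derivative there.
\<close>

locale gibbs_markov = prob_space \<mu>
  for \<mu> :: "real measure" and T :: "real \<Rightarrow> real" and P :: "real set set" +
  assumes density:
    "\<exists>h\<in>borel_measurable leb01. \<exists>c>0. \<exists>d. (\<forall>x\<in>{0..1}. c \<le> h x \<and> h x \<le> d)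
       \<and> \<mu> = density leb01 (\<lambda>x. ennreal (h x))"
  and countable_partition: "countable P"
  and partition_intervals:
    "\<And>A. A \<in> P \<Longrightarrow> A \<subseteq> {0..1} \<and> open A \<and> is_interval A \<and> measure leb01 A > 0"
  and partition_disjoint: "disjoint P"
  and partition_covers: "{0..1} - \<Union>P \<in> null_sets leb01"
  and preserving: "measure_preserving \<mu> T"
  and ergodic: "ergodic \<mu> T"
  and differentiable: "\<And>A. A \<in> P \<Longrightarrow> T differentiable_on A"
  and generating:
    "sets leb01 = \<Inter>{F. complete_sigma_algebra leb01 F \<and> preimages T P \<subseteq> F}"
  and markov: "\<And>A. A \<in> P \<Longrightarrow> \<exists>Q\<subseteq>P. sym_diff (T ` A) (\<Union>Q) \<in> null_sets leb01"
  and big_images: "\<exists>C>0. \<forall>A\<in>P. measure leb01 (T ` A) > C"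
  and invertible: "\<And>A. A \<in> P \<Longrightarrow> bij_betw T A (T ` A)"
  and expanding:
    "\<exists>\<Lambda>>1. \<forall>x\<in>{0..1}. \<forall>D. (T has_real_derivative D) (at x within {0..1}) \<longrightarrow> \<bar>D\<bar> > \<Lambda>"
  and bounded_distortion:
    "\<exists>C\<^sub>1>0. \<exists>C\<^sub>2\<ge>C\<^sub>1. \<forall>n. \<forall>A\<in>cylinders T P n. \<forall>x\<in>A. \<forall>y\<in>A.
       C\<^sub>1 \<le> \<bar>deriv (T ^^ n) x / deriv (T ^^ n) y\<bar> \<and>
       \<bar>deriv (T ^^ n) x / deriv (T ^^ n) y\<bar> \<le> C\<^sub>2"

text \<open>
  The defining property determines the transfer operator up to null sets; a version is chosen.
  On the iterates this choice has no influence up to null sets, hence none on \<^const>\<open>BV_norm\<close>.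
\<close>

definition transfer_operator ::
    "'a measure \<Rightarrow> ('a \<Rightarrow> 'a) \<Rightarrow> ('a \<Rightarrow> real) \<Rightarrow> 'a \<Rightarrow> real"
  where "transfer_operator M T g = (SOME h. integrable M h \<and>
    (\<forall>f\<in>borel_measurable M. (\<exists>C. AE x in M. \<bar>f x\<bar> \<le> C) \<longrightarrow>
       (\<integral>x. f (T x) * g x \<partial>M) = (\<integral>x. f x * h x \<partial>M)))"

definition exponential_decay_BV :: "real measure \<Rightarrow> (real \<Rightarrow> real) \<Rightarrow> bool"
  where "exponential_decay_BV \<mu> T \<longleftrightarrow>
    (\<exists>C>0. \<exists>r\<in>{0<..<1}. \<forall>g\<in>BV. (\<integral>x. g x \<partial>\<mu>) = 0 \<longrightarrow>
       (\<forall>k. BV_norm ((transfer_operator \<mu> T ^^ k) g) \<le> ennreal (C * r ^ k) * BV_norm g))"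

definition slowly_varying :: "(real \<Rightarrow> real) \<Rightarrow> bool"
  where "slowly_varying L \<longleftrightarrow>
    L \<in> borel_measurable (restrict_space borel {0<..}) \<and>
    (\<forall>\<^sub>F x in at_top. L x > 0) \<and>
    (\<forall>c>0. ((\<lambda>x. L (c * x) / L x) \<longlongrightarrow> 1) at_top)"

definition stable_domain_of_attraction ::
    "'a measure \<Rightarrow> real \<Rightarrow> ('a \<Rightarrow> real) \<Rightarrow> bool"
  where "stable_domain_of_attraction M \<alpha> \<phi> \<longleftrightarrow>
    (\<exists>L. slowly_varying L \<and>
       (\<forall>x>0. measure M {y\<in>space M. \<bar>\<phi> y\<bar> > x} = x powr (-\<alpha>) * L x)) \<and>
    (\<exists>p\<in>{0..1}. ((\<lambda>x. measure M {y\<in>space M. \<phi> y > x}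
       / measure M {y\<in>space M. \<bar>\<phi> y\<bar> > x}) \<longlongrightarrow> p) at_top)"

definition truncate :: "('a \<Rightarrow> real) \<Rightarrow> real \<Rightarrow> 'a \<Rightarrow> real"
  where "truncate \<phi> t = (\<lambda>x. \<phi> x * indicator {y. \<bar>\<phi> y\<bar> < t} x)"

end

theory Submission
  imports Defs
begin

text \<open>
  By Chebyshev's inequality it suffices that the variance of the centred Birkhoff sums of
  \<open>F = \<phi> 1{|\<phi>| < t}\<close>, \<open>t = \<epsilon> b\<^sub>n\<close>, is at most a constant times \<open>n W(t)\<close> with
  \<open>W(t) = t\<^sup>2 \<mu>(|\<phi>| > t)\<close>: since \<open>n \<mu>(|\<phi>| > \<epsilon> b\<^sub>n)\<close> tends to \<open>\<epsilon> powr (-\<alpha>)\<close>, the resulting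
  bound is of order \<open>\<epsilon> powr (2 - \<alpha>)\<close>.

  Bounding the correlation at lag \<open>k\<close> by \<open>\<parallel>F\<parallel>\<^sub>1 \<parallel>P\<^sup>k(F - E F)\<parallel>\<^sub>\<infinity>\<close> is too crude for \<open>\<alpha> > 1\<close>.  Instead
  the factor composed with \<open>T\<^sup>k\<close> is cut once more, at level \<open>u = \<rho>\<^sup>k t\<close> with \<open>\<rho>\<^sup>2\<close> the decay rate in
  \<open>BV\<close>.  The part of \<open>\<phi>\<close> below \<open>u\<close> has second moment exponentially smaller than \<open>W(t)\<close>, by regular
  variation.  The part above \<open>u\<close> is at most \<open>F\<^sup>2 / u\<close>, and the loss \<open>t / u = \<rho>\<^sup>-\<^sup>k\<close> is absorbed by the
  decay \<open>\<rho>\<^sup>2\<^sup>k\<close> of the transfer operator.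
\<close>

subsection \<open>The norm of bounded variation\<close>

lemma total_variation_diff_const:
  "total_variation S (\<lambda>x. f x - c) = total_variation S f"
  by (simp add: total_variation_def)

lemma abs_diff_le_total_variation:
  assumes "x \<in> S" "y \<in> S"
  shows "ennreal \<bar>f x - f y\<bar> \<le> total_variation S f"
proof -
  have *: "ennreal \<bar>f x - f y\<bar> \<le> total_variation S f" if "x \<in> S" "y \<in> S" "x \<le> y" for x y
  proof -
    have "ennreal \<bar>f x - f y\<bar> = (\<Sum>i<length [x,y] - 1. ennreal \<bar>f ([x,y] ! Suc i) - f ([x,y] ! i)\<bar>)"
      by (simp add: abs_minus_commute)
    also have "\<dots> \<le> total_variation S f"
      unfolding total_variation_def
      by (rule SUP_upper) (use that in auto)
    finally show ?thesis .
  qed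
  show ?thesis
    using *[of x y] *[of y x] assms by (cases "x \<le> y") (auto simp: abs_minus_commute)
qed

lemma emeasure_leb01 [simp]: "emeasure leb01 {0..1} = 1"
  by (simp add: emeasure_restrict_space)

text \<open>Decay in BV is available for functions of mean zero, so truncations have to be centred.
  A shift leaves the variation of every version unchanged and costs only in the L1 part, on a space
  of mass 1.\<close>

lemma BV_norm_diff_const:
  assumes [measurable]: "f \<in> borel_measurable leb01"
  shows "BV_norm (\<lambda>x. f x - c) \<le> BV_norm f + ennreal \<bar>c\<bar>"
proof -
  have "(INF g\<in>{g. AE x in leb01. g x = f x - c}. total_variation {0..1} g)
      \<le> (INF g\<in>{g. AE x in leb01. g x = f x}. total_variation {0..1} g)"
  proof (rule INF_greatest)
    fix g assume "g \<in> {g. AE x in leb01. g x = f x}"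
    then have "(\<lambda>x. g x - c) \<in> {g. AE x in leb01. g x = f x - c}"
      by auto
    from INF_lower[OF this, of "total_variation {0..1}"]
    show "(INF g\<in>{g. AE x in leb01. g x = f x - c}. total_variation {0..1} g)
        \<le> total_variation {0..1} g"
      by (simp add: total_variation_diff_const)
  qed
  moreover have "(\<integral>\<^sup>+ x. ennreal \<bar>f x - c\<bar> \<partial>leb01)
      \<le> (\<integral>\<^sup>+ x. ennreal \<bar>f x\<bar> \<partial>leb01) + ennreal \<bar>c\<bar>"
  proof -
    have "(\<integral>\<^sup>+ x. ennreal \<bar>f x - c\<bar> \<partial>leb01)
        \<le> (\<integral>\<^sup>+ x. ennreal \<bar>f x\<bar> + ennreal \<bar>c\<bar> \<partial>leb01)"
      by (intro nn_integral_mono) (auto simp flip: ennreal_plus)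
    also have "\<dots> = (\<integral>\<^sup>+ x. ennreal \<bar>f x\<bar> \<partial>leb01) + ennreal \<bar>c\<bar>"
      by (subst nn_integral_add) auto
    finally show ?thesis .
  qed
  ultimately show ?thesis
    unfolding BV_norm_def add.assoc by (rule add_mono)
qed

text \<open>The value at a point exceeds the average of \<open>|h|\<close> by at most the
  oscillation. The hypothesis is strict because the variation is an infimum over versions that need
  not be attained; strictness leaves room to pick one version \<open>g\<close>.\<close>

lemma AE_abs_le_BV_norm:
  assumes [measurable]: "h \<in> borel_measurable leb01"
    and B: "BV_norm h < ennreal B"
  shows "AE x in leb01. \<bar>h x\<bar> \<le> B"
proof -
  let ?I = "\<integral>\<^sup>+ x. ennreal \<bar>h x\<bar> \<partial>leb01"
  have "\<exists>g. (AE x in leb01. g x = h x) \<and> total_variation {0..1} g + ?I < ennreal B"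
  proof (rule ccontr)
    assume "\<not> ?thesis"
    then have ge: "ennreal B \<le> total_variation {0..1} g + ?I"
      if "AE x in leb01. g x = h x" for g
      using that by (auto simp: not_less)
    \<comment> \<open>Finiteness of \<open>?I\<close> is what makes its subtraction in
      \<open>ennreal\<close> reversible below.\<close>
    have "?I \<le> BV_norm h"
      unfolding BV_norm_def by (rule add_increasing) auto
    also note B
    finally have "?I \<noteq> \<infinity>"
      by auto
    have "ennreal B - ?I \<le> (INF g\<in>{g. AE x in leb01. g x = h x}. total_variation {0..1} g)"
      by (rule INF_greatest) (use ge in \<open>simp add: ennreal_minus_le_iff add.commute\<close>)
    then have "ennreal B \<le> BV_norm h"
      unfolding BV_norm_def using \<open>?I \<noteq> \<infinity>\<close> by (simp add: ennreal_minus_le_iff add.commute)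
    with B show False by simp
  qed
  then obtain g where g: "AE x in leb01. g x = h x" "total_variation {0..1} g + ?I < ennreal B"
    by blast
  have bound: "\<bar>g x\<bar> \<le> B" if "x \<in> {0..1}" for x
  proof -
    \<comment> \<open>The unit interval has mass 1, so a constant is its own integral; the triangle
      inequality is then integrated over \<open>y\<close>.\<close>
    have "ennreal \<bar>g x\<bar> = (\<integral>\<^sup>+ y. ennreal \<bar>g x\<bar> \<partial>leb01)"
      by simp
    also have "\<dots> \<le> (\<integral>\<^sup>+ y. total_variation {0..1} g + ennreal \<bar>h y\<bar> \<partial>leb01)"
    proof (rule nn_integral_mono_AE)
      have "AE y in leb01. y \<in> {0..1}"
        by (rule AE_I2) simp
      with g(1) show "AE y in leb01. ennreal \<bar>g x\<bar> \<le> total_variation {0..1} g + ennreal \<bar>h y\<bar>"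
      proof eventually_elim
        case (elim y)
        have "ennreal \<bar>g x\<bar> \<le> ennreal \<bar>g x - g y\<bar> + ennreal \<bar>g y\<bar>"
          by (simp flip: ennreal_plus)
        also have "\<dots> \<le> total_variation {0..1} g + ennreal \<bar>h y\<bar>"
          using elim that by (intro add_mono abs_diff_le_total_variation) auto
        finally show ?case .
      qed
    qed
    also have "\<dots> = total_variation {0..1} g + ?I"
      by (subst nn_integral_add) auto
    also have "\<dots> < ennreal B" by fact
    finally show ?thesis
      by (metis abs_ge_zero ennreal_less_iff less_imp_le)
  qed
  have "AE y in leb01. y \<in> {0..1}"
    by (rule AE_I2) simp
  with g(1) show ?thesis
    by eventually_elim (use bound in force)
qed

subsection \<open>The transfer operator\<close>

lemma measure_preserving_funpow:
  assumes "measure_preserving M T"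
  shows "measure_preserving M (T ^^ n)"
proof (induction n)
  case 0
  then show ?case by (simp add: measure_preserving_def distr_id id_def)
next
  case (Suc n)
  have [measurable]: "T \<in> M \<rightarrow>\<^sub>M M" "(T ^^ n) \<in> M \<rightarrow>\<^sub>M M"
    using assms Suc by (auto simp: measure_preserving_def)
  have "distr M M (T \<circ> T ^^ n) = distr (distr M M (T ^^ n)) M T"
    by (rule distr_distr[symmetric]) auto
  then show ?case
    using assms Suc by (simp add: measure_preserving_def comp_def)
qed

lemma integral_measure_preserving:
  fixes f :: "'a \<Rightarrow> real"
  assumes "measure_preserving M T" "f \<in> borel_measurable M"
  shows "(\<integral>x. f (T x) \<partial>M) = (\<integral>x. f x \<partial>M)"
  using integral_distr[of T M M f] assms by (simp add: measure_preserving_def)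

context prob_space
begin

text \<open>Radon-Nikodym: \<open>g\<close> is the density of a finite measure, its image
  \<open>N\<close> under \<open>T\<close> is absolutely continuous because \<open>T\<close>
  preserves null sets, and \<open>h\<close> is the density of \<open>N\<close>. The change of
  variables respects the default value 0 of divergent integrals, so \<open>f\<close> may be
  unbounded.\<close>

lemma transfer_exists_nonneg:
  fixes g :: "'a \<Rightarrow> real"
  assumes T: "measure_preserving M T" and g: "integrable M g" "\<And>x. g x \<ge> 0"
  shows "\<exists>h. integrable M h \<and> (\<forall>f\<in>borel_measurable M. (\<integral>x. f (T x) * g x \<partial>M) = (\<integral>x. f x * h x \<partial>M))"
proof -
  have [measurable]: "T \<in> M \<rightarrow>\<^sub>M M" "g \<in> borel_measurable M"
    using T g by (auto simp: measure_preserving_def)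
  define N where "N = distr (density M g) M T"
  have "T -` space M \<inter> space M = space M"
    using measurable_space[of T M M] by auto
  then have fin: "emeasure N (space M) < \<infinity>"
    using g by (simp add: N_def emeasure_distr emeasure_density space_density nn_integral_eq_integral
        cong: nn_integral_cong)
  interpret N: finite_measure N
    using fin by (intro finite_measureI) (auto simp: N_def)
  have ac: "absolutely_continuous M N"
    unfolding absolutely_continuous_def
  proof
    fix A assume A: "A \<in> null_sets M"
    then have [measurable]: "A \<in> sets M" by auto
    have "emeasure M (T -` A \<inter> space M) = emeasure (distr M M T) A"
      by (subst emeasure_distr) auto
    also have "\<dots> = 0"
      using A T by (auto simp: measure_preserving_def)
    finally have "T -` A \<inter> space M \<in> null_sets M"
      by (auto intro!: null_setsI)
    then have "T -` A \<inter> space M \<in> null_sets (density M g)"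
      using absolutely_continuousI_density[of "\<lambda>x. ennreal (g x)" M]
      by (auto simp: absolutely_continuous_def)
    then show "A \<in> null_sets N"
      unfolding N_def by (intro null_setsI) (auto simp: emeasure_distr space_density)
  qed
  obtain D where D [measurable]: "D \<in> borel_measurable M"
    and D': "AE x in M. RN_deriv M N x = ennreal (D x)" and D0: "\<And>x. 0 \<le> D x"
    using real_RN_deriv[OF N.finite_measure_axioms ac] by (auto simp: N_def)
  have N_eq: "N = density M D"
  proof -
    have "N = density M (RN_deriv M N)"
      by (rule density_RN_deriv[OF ac, symmetric]) (simp add: N_def)
    also have "\<dots> = density M D"
      using D' by (intro density_cong) auto
    finally show ?thesis .
  qed
  have "integrable M D"
    using fin D0 by (intro integrableI_nonneg) (auto simp: N_eq emeasure_density space_density cong: nn_integral_cong)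
  moreover have "(\<integral>x. f (T x) * g x \<partial>M) = (\<integral>x. f x * D x \<partial>M)" if [measurable]: "f \<in> borel_measurable M" for f
  proof -
    have "(\<integral>x. f x * D x \<partial>M) = (\<integral>x. f x \<partial>N)"
      unfolding N_eq using D0 by (subst integral_density) (auto simp: mult.commute)
    also have "\<dots> = (\<integral>x. f (T x) \<partial>density M g)"
      unfolding N_def by (subst integral_distr) auto
    also have "\<dots> = (\<integral>x. f (T x) * g x \<partial>M)"
      using g by (subst integral_density) (auto simp: mult.commute)
    finally show ?thesis by simp
  qed
  ultimately show ?thesis by blast
qed

text \<open>The operator is defined by \<open>SOME\<close>, so its properties rest on one witness:
  the difference of the densities obtained for the positive and the negative part of
  \<open>g\<close>.\<close>

lemma transfer_operator_spec:
  fixes g :: "'a \<Rightarrow> real"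
  assumes T: "measure_preserving M T" and g: "integrable M g"
  shows integrable_transfer_operator: "integrable M (transfer_operator M T g)"
    and transfer_operator_dual: "\<And>f C. f \<in> borel_measurable M \<Longrightarrow> (\<And>x. \<bar>f x\<bar> \<le> C) \<Longrightarrow>
      (\<integral>x. f (T x) * g x \<partial>M) = (\<integral>x. f x * transfer_operator M T g x \<partial>M)"
proof -
  have T_meas [measurable]: "T \<in> M \<rightarrow>\<^sub>M M"
    using T by (simp add: measure_preserving_def)
  let ?gp = "\<lambda>x. max 0 (g x)" and ?gn = "\<lambda>x. max 0 (- g x)"
  have int: "integrable M ?gp" "integrable M ?gn"
    using g by auto
  obtain hp where hp: "integrable M hp"
    "\<And>f. f \<in> borel_measurable M \<Longrightarrow> (\<integral>x. f (T x) * ?gp x \<partial>M) = (\<integral>x. f x * hp x \<partial>M)"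
    using transfer_exists_nonneg[OF T int(1)] by auto
  obtain hn where hn: "integrable M hn"
    "\<And>f. f \<in> borel_measurable M \<Longrightarrow> (\<integral>x. f (T x) * ?gn x \<partial>M) = (\<integral>x. f x * hn x \<partial>M)"
    using transfer_exists_nonneg[OF T int(2)] by auto
  define Q where "Q h \<longleftrightarrow> integrable M h \<and>
    (\<forall>f\<in>borel_measurable M. (\<exists>C. AE x in M. \<bar>f x\<bar> \<le> C) \<longrightarrow>
       (\<integral>x. f (T x) * g x \<partial>M) = (\<integral>x. f x * h x \<partial>M))" for h
  have "Q (\<lambda>x. hp x - hn x)"
    unfolding Q_def
  proof (intro conjI ballI impI)
    fix f :: "'a \<Rightarrow> real" assume f [measurable]: "f \<in> borel_measurable M" and "\<exists>C. AE x in M. \<bar>f x\<bar> \<le> C"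
    then obtain C :: real where C: "AE x in M. \<bar>f x\<bar> \<le> C" by blast
    \<comment> \<open>Integrals of the two parts may be subtracted only if both products are
      integrable; this is where the bound on \<open>f\<close> enters.\<close>
    have bd: "integrable M (\<lambda>x. u x * v x)"
      if [measurable]: "u \<in> borel_measurable M" and "AE x in M. \<bar>u x\<bar> \<le> C" "integrable M v" for u v :: "'a \<Rightarrow> real"
    proof (rule Bochner_Integration.integrable_bound)
      show "integrable M (\<lambda>x. C * v x)" using that by auto
      show "(\<lambda>x. u x * v x) \<in> borel_measurable M" using that by auto
      show "AE x in M. norm (u x * v x) \<le> norm (C * v x)"
        using that(2) by eventually_elim (auto simp: abs_mult intro!: mult_right_mono)
    qed
    \<comment> \<open>An almost sure bound on \<open>f\<close> passes to \<open>f\<close> composed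
      with \<open>T\<close> by invariance of the measure.\<close>
    have CT: "AE x in M. \<bar>f (T x)\<bar> \<le> C"
    proof -
      have "AE x in distr M M T. \<bar>f x\<bar> \<le> C"
        using C T unfolding measure_preserving_def by metis
      then show ?thesis by (subst (asm) AE_distr_iff) auto
    qed
    have "(\<integral>x. f (T x) * g x \<partial>M) = (\<integral>x. f (T x) * ?gp x - f (T x) * ?gn x \<partial>M)"
      by (intro Bochner_Integration.integral_cong) (auto simp: max_def)
    also have "\<dots> = (\<integral>x. f (T x) * ?gp x \<partial>M) - (\<integral>x. f (T x) * ?gn x \<partial>M)"
      using int CT by (intro Bochner_Integration.integral_diff bd) auto
    also have "\<dots> = (\<integral>x. f x * hp x \<partial>M) - (\<integral>x. f x * hn x \<partial>M)"
      using hp hn by simp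
    also have "\<dots> = (\<integral>x. f x * hp x - f x * hn x \<partial>M)"
      using hp hn C by (intro Bochner_Integration.integral_diff[symmetric] bd) auto
    also have "\<dots> = (\<integral>x. f x * (hp x - hn x) \<partial>M)"
      by (simp add: right_diff_distrib)
    finally show "(\<integral>x. f (T x) * g x \<partial>M) = (\<integral>x. f x * (hp x - hn x) \<partial>M)" .
  qed (use hp hn in auto)
  then have "Q (SOME h. Q h)"
    by (rule someI[of Q])
  then have "Q (transfer_operator M T g)"
    unfolding transfer_operator_def Q_def .
  then show "integrable M (transfer_operator M T g)"
    and "\<And>f C. f \<in> borel_measurable M \<Longrightarrow> (\<And>x. \<bar>f x\<bar> \<le> C) \<Longrightarrow>
      (\<integral>x. f (T x) * g x \<partial>M) = (\<integral>x. f x * transfer_operator M T g x \<partial>M)"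
    unfolding Q_def by (blast intro: AE_I2)+
qed

lemma integrable_transfer_operator_funpow:
  fixes g :: "'a \<Rightarrow> real"
  assumes "measure_preserving M T" "integrable M g"
  shows "integrable M ((transfer_operator M T ^^ k) g)"
  using assms by (induction k) (auto intro: integrable_transfer_operator)

lemma transfer_operator_funpow_dual:
  fixes g :: "'a \<Rightarrow> real"
  assumes T: "measure_preserving M T" and g: "integrable M g"
    and "f \<in> borel_measurable M" "\<And>x. \<bar>f x\<bar> \<le> C"
  shows "(\<integral>x. f ((T ^^ k) x) * g x \<partial>M) = (\<integral>x. f x * (transfer_operator M T ^^ k) g x \<partial>M)"
  using assms(3,4)
\<comment> \<open>\<open>f\<close> is generalised because the induction hypothesis is applied to
  \<open>f\<close> composed with \<open>T\<close>.\<close>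
proof (induction k arbitrary: f)
  case (Suc k)
  have [measurable]: "T \<in> M \<rightarrow>\<^sub>M M" "f \<in> borel_measurable M"
    using T Suc by (auto simp: measure_preserving_def)
  have "(\<integral>x. f ((T ^^ Suc k) x) * g x \<partial>M) = (\<integral>x. f (T x) * (transfer_operator M T ^^ k) g x \<partial>M)"
    using Suc.IH[of "\<lambda>x. f (T x)"] Suc.prems by simp
  also have "\<dots> = (\<integral>x. f x * (transfer_operator M T ^^ Suc k) g x \<partial>M)"
    using transfer_operator_dual[OF T integrable_transfer_operator_funpow[OF T g], of f C k] Suc.prems
    by simp
  finally show ?case .
qed simp

end

subsection \<open>Moments of truncations\<close>

text \<open>A discrete version of Karamata's theorem, with \<open>V\<close> in the role of a
  truncated second moment and \<open>W t\<close> of \<open>t^2\<close> times the tail. One step down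
  in scale costs \<open>C\<^sub>1 * W t\<close>, and \<open>W\<close> contracts by \<sigma>, so the
  costs add up like a geometric series. Scales below \<open>t\<^sub>1\<close> are covered by
  \<open>V x \<le> x^2\<close>.\<close>

lemma geometric_scaling_bound:
  fixes V W :: "real \<Rightarrow> real"
  assumes \<rho>: "0 < \<rho>" "\<rho> < 1" and \<sigma>: "\<sigma> < 1" "\<rho>\<^sup>2 \<le> \<sigma>"
    and V_le: "\<And>x. x > 0 \<Longrightarrow> V x \<le> x\<^sup>2"
    and W: "\<And>x. W x \<ge> 0" and "t\<^sub>1 > 0"
    and step: "\<And>t. t \<ge> t\<^sub>1 \<Longrightarrow> V t \<le> V (\<rho> * t) + C\<^sub>1 * W t"
    and W_step: "\<And>t. t \<ge> t\<^sub>1 \<Longrightarrow> W (\<rho> * t) \<le> \<sigma> * W t"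
    and base: "\<And>t. t\<^sub>1 \<le> t \<Longrightarrow> t \<le> t\<^sub>1 / \<rho> \<Longrightarrow> t\<^sup>2 \<le> C\<^sub>0 * W t"
  shows "\<exists>C>0. \<forall>t\<ge>t\<^sub>1. \<forall>k. V (\<rho> ^ k * t) \<le> C * \<sigma> ^ k * W t"
proof -
  \<comment> \<open>The third entry solves \<open>C * \<sigma> + C\<^sub>1 = C\<close>, so the bound
    reproduces itself in each step; \<open>C\<^sub>0\<close> covers the lowest scales and 1 ensures
    positivity.\<close>
  define C where "C = max 1 (max C\<^sub>0 (C\<^sub>1 / (1 - \<sigma>)))"
  have "C > 0" "C\<^sub>0 \<le> C" and "C\<^sub>1 / (1 - \<sigma>) \<le> C"
    by (auto simp: C_def)
  then have C: "C * \<sigma> + C\<^sub>1 \<le> C"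
    using \<sigma> by (simp add: field_simps)
  have "\<sigma> > 0"
    using \<sigma> \<rho> by (meson less_le_trans zero_less_power)
  have base': "t\<^sup>2 \<le> C * W t" if "t\<^sub>1 \<le> t" "t \<le> t\<^sub>1 / \<rho>" for t
    using base[OF that] mult_right_mono[OF \<open>C\<^sub>0 \<le> C\<close> W[of t]] by linarith
  have V_base: "V t \<le> C * W t" if "t\<^sub>1 \<le> t" "t \<le> t\<^sub>1 / \<rho>" for t
    using base'[OF that] V_le[of t] that \<open>t\<^sub>1 > 0\<close> by linarith
  \<comment> \<open>Case \<open>k = 0\<close> of the claim. The induction is on a number
    \<open>n\<close> of contractions that brings \<open>t\<close> below
    \<open>t\<^sub>1\<close>.\<close>
  have V0: "V t \<le> C * W t" if "t\<^sub>1 \<le> t" "\<rho> ^ n * t \<le> t\<^sub>1" for n t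
    using that
  proof (induction n arbitrary: t)
    case 0
    have "t\<^sub>1 \<le> t\<^sub>1 / \<rho>"
      using \<rho> \<open>t\<^sub>1 > 0\<close> by (simp add: field_simps)
    with 0 show ?case by (intro V_base) auto
  next
    case (Suc n)
    show ?case
    proof (cases "t\<^sub>1 \<le> \<rho> * t")
      case True
      have "V t \<le> V (\<rho> * t) + C\<^sub>1 * W t"
        by (rule step) fact
      also have "V (\<rho> * t) \<le> C * W (\<rho> * t)"
        using Suc True by (intro Suc.IH) (auto simp: mult_ac)
      also have "\<dots> \<le> C * (\<sigma> * W t)"
        using W_step[OF Suc.prems(1)] \<open>C > 0\<close> by simp
      also have "C * (\<sigma> * W t) + C\<^sub>1 * W t = (C * \<sigma> + C\<^sub>1) * W t"
        by (simp add: algebra_simps)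
      also have "\<dots> \<le> C * W t"
        using C W[of t] by (rule mult_right_mono)
      finally show ?thesis by simp
    next
      case False
      with Suc \<rho> show ?thesis by (intro V_base) (auto simp: field_simps)
    qed
  qed
  have "V (\<rho> ^ k * t) \<le> C * \<sigma> ^ k * W t" if "t\<^sub>1 \<le> t" for k t
    using that
  proof (induction k arbitrary: t)
    case 0
    then have "t > 0" using \<open>t\<^sub>1 > 0\<close> by simp
    obtain n where "\<rho> ^ n < t\<^sub>1 / t"
      using real_arch_pow_inv[of "t\<^sub>1 / t" \<rho>] \<rho> \<open>t > 0\<close> \<open>t\<^sub>1 > 0\<close> by auto
    then have "\<rho> ^ n * t \<le> t\<^sub>1"
      using \<open>t > 0\<close> by (simp add: field_simps)
    with V0 0 show ?case by simp
  next
    case (Suc k)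
    show ?case
    proof (cases "t\<^sub>1 \<le> \<rho> * t")
      case True
      have "V (\<rho> ^ Suc k * t) \<le> C * \<sigma> ^ k * W (\<rho> * t)"
        using Suc.IH[OF True] by (simp add: mult_ac)
      also have "\<dots> \<le> C * \<sigma> ^ k * (\<sigma> * W t)"
        using W_step[OF Suc.prems] \<open>C > 0\<close> \<open>\<sigma> > 0\<close> by (intro mult_left_mono) auto
      finally show ?thesis by (simp add: mult_ac)
    next
      \<comment> \<open>Now \<open>t\<close> lies between \<open>t\<^sub>1\<close> and
        \<open>t\<^sub>1 / \<rho>\<close>, where \<open>t^2\<close> is at most
        \<open>C * W t\<close>. The crude bound on \<open>V\<close> supplies the factor
        \<open>(\<rho>^2) ^ Suc k\<close>, which is at most \<open>\<sigma> ^ Suc k\<close>.\<close>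
      case False
      then have t: "t \<le> t\<^sub>1 / \<rho>"
        using \<rho> by (simp add: field_simps)
      have "t > 0" using Suc \<open>t\<^sub>1 > 0\<close> by simp
      then have "V (\<rho> ^ Suc k * t) \<le> (\<rho> ^ Suc k * t)\<^sup>2"
        using \<rho> by (intro V_le) auto
      also have "\<dots> = (\<rho>\<^sup>2) ^ Suc k * t\<^sup>2"
        by (simp add: power_mult_distrib mult.commute flip: power_mult)
      also have "\<dots> \<le> \<sigma> ^ Suc k * (C * W t)"
        using \<sigma> \<open>\<sigma> > 0\<close> \<open>t > 0\<close> by (intro mult_mono power_mono base' Suc.prems t) auto
      finally show ?thesis by (simp add: mult_ac)
    qed
  qed
  with \<open>C > 0\<close> show ?thesis by blast
qed

section \<open>Truncations and regularly varying tails\<close>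

lemma measurable_truncate [measurable]:
  "\<phi> \<in> borel_measurable M \<Longrightarrow> truncate \<phi> t \<in> borel_measurable M"
proof -
  assume [measurable]: "\<phi> \<in> borel_measurable M"
  have "truncate \<phi> t = (\<lambda>x. if \<bar>\<phi> x\<bar> < t then \<phi> x else 0)"
    by (auto simp: truncate_def indicator_def)
  then show ?thesis by simp
qed

lemma abs_truncate_le: "t > 0 \<Longrightarrow> \<bar>truncate \<phi> t x\<bar> \<le> t"
  by (auto simp: truncate_def indicator_def)

text \<open>The difference lives where \<open>u \<le> |\<phi>| < t\<close>, and there
  \<open>|\<phi>| \<le> |\<phi>|^2 / u\<close>. This trades a first moment for a second one.\<close>

lemma abs_truncate_diff_le:
  assumes "0 < u" "u \<le> t"
  shows "\<bar>truncate \<phi> t x - truncate \<phi> u x\<bar> \<le> (truncate \<phi> t x)\<^sup>2 / u"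
proof (cases "u \<le> \<bar>\<phi> x\<bar>")
  case True
  then have "\<bar>\<phi> x\<bar> * u \<le> \<bar>\<phi> x\<bar> * \<bar>\<phi> x\<bar>"
    by (intro mult_left_mono) auto
  then show ?thesis
    using assms True by (auto simp: truncate_def indicator_def field_simps power2_eq_square)
next
  case False
  then show ?thesis
    using assms by (auto simp: truncate_def indicator_def)
qed

text \<open>Regular variation enters the estimates only through this limit and the positivity in
  \<open>tail_pos\<close>.\<close>

lemma tail_ratio_tendsto:
  assumes "stable_domain_of_attraction M \<alpha> \<phi>" and "c > 0"
  shows "((\<lambda>x. measure M {y\<in>space M. \<bar>\<phi> y\<bar> > c * x} / measure M {y\<in>space M. \<bar>\<phi> y\<bar> > x})
    \<longlongrightarrow> c powr (-\<alpha>)) at_top"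
proof -
  obtain L where L: "slowly_varying L"
    and tail: "\<And>x. x > 0 \<Longrightarrow> measure M {y\<in>space M. \<bar>\<phi> y\<bar> > x} = x powr (-\<alpha>) * L x"
    using assms by (auto simp: stable_domain_of_attraction_def)
  have "((\<lambda>x. c powr (-\<alpha>) * (L (c * x) / L x)) \<longlongrightarrow> c powr (-\<alpha>) * 1) at_top"
    using L assms by (intro tendsto_intros) (auto simp: slowly_varying_def)
  moreover have "\<forall>\<^sub>F x in at_top. c powr (-\<alpha>) * (L (c * x) / L x)
      = measure M {y\<in>space M. \<bar>\<phi> y\<bar> > c * x} / measure M {y\<in>space M. \<bar>\<phi> y\<bar> > x}"
    using eventually_gt_at_top[of 0]
    by eventually_elim (use assms in \<open>simp add: tail powr_mult\<close>)
  ultimately show ?thesis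
    by (auto intro: Lim_transform_eventually)
qed

context prob_space
begin

text \<open>Slow variation gives positivity for large arguments; monotonicity carries it down to
  every \<open>x\<close>. Ratios of tails thus never have denominator 0.\<close>

lemma tail_pos:
  fixes x :: real
  assumes [measurable]: "\<phi> \<in> borel_measurable M" and "stable_domain_of_attraction M \<alpha> \<phi>"
  shows "measure M {y\<in>space M. \<bar>\<phi> y\<bar> > x} > 0"
proof -
  obtain L where L: "slowly_varying L"
    and tail: "\<And>x. x > 0 \<Longrightarrow> measure M {y\<in>space M. \<bar>\<phi> y\<bar> > x} = x powr (-\<alpha>) * L x"
    using assms by (auto simp: stable_domain_of_attraction_def)
  have "\<forall>\<^sub>F z in at_top. L z > 0 \<and> z > max x 0"
    using L by (intro eventually_conj eventually_gt_at_top) (simp add: slowly_varying_def)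
  then obtain z where z: "L z > 0" "z > max x 0"
    using eventually_happens[of _ "at_top :: real filter"] by auto
  then have "0 < measure M {y\<in>space M. \<bar>\<phi> y\<bar> > z}"
    by (simp add: tail)
  also have "\<dots> \<le> measure M {y\<in>space M. \<bar>\<phi> y\<bar> > x}"
    using z by (intro finite_measure_mono) auto
  finally show ?thesis .
qed

lemma integrable_bounded:
  fixes f :: "'a \<Rightarrow> real"
  assumes "f \<in> borel_measurable M" "\<And>x. \<bar>f x\<bar> \<le> C"
  shows "integrable M f"
  using assms by (intro integrable_const_bound[of _ C]) auto

text \<open>Where the truncations differ, \<open>|\<phi>| \<ge> u\<close> and the square is at most
  \<open>t^2\<close>. The level \<open>u / 2\<close> turns this into the strict inequality used in
  the tail.\<close>

lemma truncated_moment_le: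
  assumes [measurable]: "\<phi> \<in> borel_measurable M" and "0 < u" "u \<le> t"
  shows "expectation (\<lambda>x. (truncate \<phi> t x)\<^sup>2)
    \<le> expectation (\<lambda>x. (truncate \<phi> u x)\<^sup>2) + t\<^sup>2 * measure M {x\<in>space M. \<bar>\<phi> x\<bar> > u / 2}"
proof -
  let ?A = "{x\<in>space M. \<bar>\<phi> x\<bar> > u / 2}"
  have sq: "integrable M (\<lambda>x. (truncate \<phi> s x)\<^sup>2)" if "s > 0" for s
  proof (rule integrable_bounded)
    show "\<bar>(truncate \<phi> s x)\<^sup>2\<bar> \<le> s\<^sup>2" for x
      using abs_truncate_le[of s \<phi> x] that power_mono[of "\<bar>truncate \<phi> s x\<bar>" s 2] by simp
  qed auto
  have "expectation (\<lambda>x. (truncate \<phi> t x)\<^sup>2)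
      \<le> expectation (\<lambda>x. (truncate \<phi> u x)\<^sup>2 + t\<^sup>2 * indicator ?A x)"
  proof (intro integral_mono Bochner_Integration.integrable_add sq)
    show "integrable M (\<lambda>x. t\<^sup>2 * indicator ?A x)"
      by (intro integrable_mult_right integrable_real_indicator) (auto simp: emeasure_eq_measure)
    show "(truncate \<phi> t x)\<^sup>2 \<le> (truncate \<phi> u x)\<^sup>2 + t\<^sup>2 * indicator ?A x" if "x \<in> space M" for x
    proof (cases "\<bar>\<phi> x\<bar> < u")
      case True
      then show ?thesis using assms that by (auto simp: truncate_def)
    next
      case False
      have "(truncate \<phi> t x)\<^sup>2 \<le> t\<^sup>2"
        using abs_truncate_le[of t \<phi> x] assms power_mono[of "\<bar>truncate \<phi> t x\<bar>" t 2] by simp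
      then show ?thesis using False assms that by (auto intro: add_increasing)
    qed
  qed (use assms in auto)
  also have "\<dots> = expectation (\<lambda>x. (truncate \<phi> u x)\<^sup>2) + t\<^sup>2 * measure M ?A"
    using assms by (subst Bochner_Integration.integral_add)
      (auto intro!: sq integrable_mult_right integrable_real_indicator simp: emeasure_eq_measure)
  finally show ?thesis .
qed

lemma truncated_moment_le_sq:
  assumes [measurable]: "\<phi> \<in> borel_measurable M" and "0 < t"
  shows "expectation (\<lambda>x. (truncate \<phi> t x)\<^sup>2) \<le> t\<^sup>2"
proof (rule integral_le_const)
  have *: "(truncate \<phi> t x)\<^sup>2 \<le> t\<^sup>2" for x
    using abs_truncate_le[of t \<phi> x] assms power_mono[of "\<bar>truncate \<phi> t x\<bar>" t 2] by simp
  then show "AE x in M. (truncate \<phi> t x)\<^sup>2 \<le> t\<^sup>2" by simp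
  show "integrable M (\<lambda>x. (truncate \<phi> t x)\<^sup>2)"
    using * by (intro integrable_bounded[of _ "t\<^sup>2"]) auto
qed

text \<open>For \<open>W t = t^2 * H t\<close> the ratio \<open>W (\<rho> * t) / W t\<close> tends
  to \<open>\<rho> powr (2 - \<alpha>)\<close>. Halving the exponent gives a strictly larger rate
  \<sigma>, still below 1, which therefore bounds the ratio for all large \<open>t\<close>.\<close>

lemma truncated_moment_scaling:
  fixes \<phi> :: "'a \<Rightarrow> real"
  defines "H \<equiv> \<lambda>x. measure M {y\<in>space M. \<bar>\<phi> y\<bar> > x}"
  assumes [measurable]: "\<phi> \<in> borel_measurable M" and dom: "stable_domain_of_attraction M \<alpha> \<phi>"
    and \<alpha>: "0 < \<alpha>" "\<alpha> < 2" and \<rho>: "0 < \<rho>" "\<rho> < 1"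
  shows "\<exists>C>0. \<exists>t\<^sub>1>0. \<forall>t\<ge>t\<^sub>1. \<forall>k.
    expectation (\<lambda>x. (truncate \<phi> (\<rho> ^ k * t) x)\<^sup>2) \<le> C * (\<rho> powr ((2 - \<alpha>) / 2)) ^ k * (t\<^sup>2 * H t)"
proof -
  define \<sigma> where "\<sigma> = \<rho> powr ((2 - \<alpha>) / 2)"
  have H_pos: "H x > 0" for x
    unfolding H_def using tail_pos dom by simp
  have W_nonneg: "0 \<le> x\<^sup>2 * H x" for x
    using H_pos[of x] by simp
  have H_mono: "H y \<le> H x" if "x \<le> y" for x y
    unfolding H_def using that by (intro finite_measure_mono) auto
  have "\<sigma> < 1"
    using \<rho> \<alpha> powr_less_mono'[of \<rho> 0 "(2 - \<alpha>) / 2"] by (simp add: \<sigma>_def)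
  have "\<rho> powr 2 \<le> \<sigma>"
    unfolding \<sigma>_def using \<rho> \<alpha> by (intro powr_mono') auto
  then have "\<rho>\<^sup>2 \<le> \<sigma>"
    using \<rho> by simp
  have "\<rho> powr (2 - \<alpha>) < \<sigma>"
    unfolding \<sigma>_def using \<rho> \<alpha> by (intro powr_less_mono') auto
  then have "\<rho> powr (-\<alpha>) < \<sigma> / \<rho>\<^sup>2"
    using \<rho> by (simp add: field_simps powr_diff powr_minus)
  then have "\<forall>\<^sub>F t in at_top. H (\<rho> * t) / H t < \<sigma> / \<rho>\<^sup>2"
    using order_tendstoD(2)[OF tail_ratio_tendsto[OF dom \<open>0 < \<rho>\<close>]] by (simp add: H_def)
  \<comment> \<open>The limit of the ratio at factor \<open>\<rho> / 2\<close>, raised by 1 to be a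
    strict bound. The factor comes from \<open>truncated_moment_le\<close> with
    \<open>u = \<rho> * t\<close>.\<close>
  moreover define C\<^sub>1 where "C\<^sub>1 = (\<rho> / 2) powr (-\<alpha>) + 1"
  have "\<forall>\<^sub>F t in at_top. H (\<rho> / 2 * t) / H t < C\<^sub>1"
    using order_tendstoD(2)[OF tail_ratio_tendsto[OF dom, of "\<rho> / 2"], of C\<^sub>1] \<rho>
    by (simp add: H_def C\<^sub>1_def)
  ultimately have "\<forall>\<^sub>F t in at_top. H (\<rho> * t) / H t < \<sigma> / \<rho>\<^sup>2 \<and> H (\<rho> / 2 * t) / H t < C\<^sub>1"
    by (rule eventually_conj)
  then obtain t\<^sub>0 where t\<^sub>0: "\<And>t. t \<ge> t\<^sub>0 \<Longrightarrow> H (\<rho> * t) / H t < \<sigma> / \<rho>\<^sup>2 \<and> H (\<rho> / 2 * t) / H t < C\<^sub>1"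
    by (auto simp: eventually_at_top_linorder)
  define t\<^sub>1 where "t\<^sub>1 = max t\<^sub>0 1"
  have "t\<^sub>1 > 0" by (simp add: t\<^sub>1_def)
  have "\<exists>C>0. \<forall>t\<ge>t\<^sub>1. \<forall>k.
    expectation (\<lambda>x. (truncate \<phi> (\<rho> ^ k * t) x)\<^sup>2) \<le> C * \<sigma> ^ k * (t\<^sup>2 * H t)"
  \<comment> \<open>On the lowest scales \<open>t \<le> t\<^sub>1 / \<rho>\<close>, so
    \<open>H t\<close> is at least \<open>H (t\<^sub>1 / \<rho>)\<close>; this gives
    \<open>C\<^sub>0\<close>.\<close>
  proof (rule geometric_scaling_bound[where C\<^sub>0 = "1 / H (t\<^sub>1 / \<rho>)" and C\<^sub>1 = C\<^sub>1])
    fix t assume t: "t \<ge> t\<^sub>1"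
    then have "t > 0" using \<open>t\<^sub>1 > 0\<close> by simp
    have "t \<ge> t\<^sub>0" using t by (simp add: t\<^sub>1_def)
    show "(\<rho> * t)\<^sup>2 * H (\<rho> * t) \<le> \<sigma> * (t\<^sup>2 * H t)"
      using t\<^sub>0[OF \<open>t \<ge> t\<^sub>0\<close>] \<rho> H_pos[of t] \<open>t > 0\<close>
      by (simp add: field_simps power_mult_distrib)
    have "expectation (\<lambda>x. (truncate \<phi> t x)\<^sup>2)
      \<le> expectation (\<lambda>x. (truncate \<phi> (\<rho> * t) x)\<^sup>2) + t\<^sup>2 * H (\<rho> * t / 2)"
      unfolding H_def using \<rho> \<open>t > 0\<close> by (intro truncated_moment_le) (auto intro: mult_left_le_one_le)
    also have "t\<^sup>2 * H (\<rho> * t / 2) \<le> t\<^sup>2 * (C\<^sub>1 * H t)"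
      using t\<^sub>0[OF \<open>t \<ge> t\<^sub>0\<close>] H_pos[of t] by (intro mult_left_mono) (auto simp: field_simps)
    finally show "expectation (\<lambda>x. (truncate \<phi> t x)\<^sup>2)
      \<le> expectation (\<lambda>x. (truncate \<phi> (\<rho> * t) x)\<^sup>2) + C\<^sub>1 * (t\<^sup>2 * H t)"
      by (simp add: mult_ac)
    assume "t \<le> t\<^sub>1 / \<rho>"
    then show "t\<^sup>2 \<le> 1 / H (t\<^sub>1 / \<rho>) * (t\<^sup>2 * H t)"
      using H_mono[of t "t\<^sub>1 / \<rho>"] H_pos[of "t\<^sub>1 / \<rho>"] mult_left_mono[of "H (t\<^sub>1 / \<rho>)" "H t" "t\<^sup>2"]
      by (simp add: field_simps)
  qed (use \<rho> \<open>\<sigma> < 1\<close> \<open>\<rho>\<^sup>2 \<le> \<sigma>\<close> H_pos \<open>t\<^sub>1 > 0\<close> truncated_moment_le_sq W_nonneg in auto)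
  with \<open>t\<^sub>1 > 0\<close> show ?thesis
    unfolding \<sigma>_def by blast
qed

end

subsection \<open>Decay of correlations\<close>

text \<open>Young's inequality. The free weight \<open>s\<close> later balances two second moments
  of very different size.\<close>

lemma abs_mult_le_weighted:
  fixes x y s :: real
  assumes "s > 0"
  shows "\<bar>x * y\<bar> \<le> (s * x\<^sup>2 + y\<^sup>2 / s) / 2"
proof -
  have "0 \<le> (s * \<bar>x\<bar> - \<bar>y\<bar>)\<^sup>2 / s"
    using assms by simp
  also have "\<dots> = s * x\<^sup>2 + y\<^sup>2 / s - 2 * \<bar>x * y\<bar>"
    using assms by (simp add: power2_diff abs_mult field_simps power2_eq_square)
  finally show ?thesis by simp
qed

lemma sum_power_inj_le:
  fixes q :: real
  assumes "0 \<le> q" "q < 1" "finite S" "inj_on g S"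
  shows "(\<Sum>j\<in>S. q ^ g j) \<le> 1 / (1 - q)"
proof -
  have "(\<Sum>j\<in>S. q ^ g j) = (\<Sum>k\<in>g ` S. q ^ k)"
    using assms by (simp add: sum.reindex)
  also have "\<dots> \<le> (\<Sum>k. q ^ k)"
    using assms by (intro sum_le_suminf summable_geometric) auto
  also have "\<dots> = 1 / (1 - q)"
    using assms by (simp add: suminf_geometric)
  finally show ?thesis .
qed

context prob_space
begin

text \<open>Only the factor composed with \<open>T^k\<close> is cut, so that the transfer operator
  acts on the whole centred truncation. The part below \<open>u\<close> needs no decay, only Young's
  inequality and invariance; the part between \<open>u\<close> and \<open>t\<close> is moved across
  by duality and meets the bound \<open>B\<close>. The parameters \<open>u\<close> and
  \<open>s\<close> stay free for later optimisation.\<close>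

lemma correlation_split_bound:
  fixes \<phi> :: "'a \<Rightarrow> real" and k :: nat
  defines "V \<equiv> \<lambda>s. expectation (\<lambda>x. (truncate \<phi> s x)\<^sup>2)"
    and "G \<equiv> \<lambda>t x. truncate \<phi> t x - expectation (truncate \<phi> t)"
  assumes T: "measure_preserving M T" and \<phi> [measurable]: "\<phi> \<in> borel_measurable M"
    and u: "0 < u" "u \<le> t" and s: "s > 0"
    and B: "AE x in M. \<bar>(transfer_operator M T ^^ k) (G t) x\<bar> \<le> B"
  shows "\<bar>expectation (\<lambda>x. G t ((T ^^ k) x) * G t x)\<bar> \<le> (s * V u + V t / s) / 2 + B * V t / u"
proof -
  have "t > 0" using u by simp
  have Tk: "measure_preserving M (T ^^ k)"
    by (rule measure_preserving_funpow[OF T])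
  then have [measurable]: "(T ^^ k) \<in> M \<rightarrow>\<^sub>M M"
    by (simp add: measure_preserving_def)
  have [measurable]: "G t \<in> borel_measurable M"
    by (simp add: G_def)
  define m where "m = expectation (truncate \<phi> t)"
  define D where "D x = truncate \<phi> t x - truncate \<phi> u x" for x
  have [measurable]: "D \<in> borel_measurable M"
    unfolding D_def[abs_def] by measurable
  have trunc: "\<bar>truncate \<phi> u x\<bar> \<le> t" "\<bar>truncate \<phi> t x\<bar> \<le> t" for x
    using abs_truncate_le[of u \<phi> x] abs_truncate_le[of t \<phi> x] u by auto
  have D: "\<bar>D x\<bar> \<le> 2 * t" for x
    using trunc[of x] by (simp add: D_def)
  have G: "\<bar>G t x\<bar> \<le> t + \<bar>m\<bar>" for x
    using trunc[of x] by (simp add: G_def m_def)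
  have prod: "integrable M (\<lambda>x. f x * g x)"
    if "f \<in> borel_measurable M" "g \<in> borel_measurable M" "\<And>x. \<bar>f x\<bar> \<le> a" "\<And>x. \<bar>g x\<bar> \<le> b"
    for f g :: "'a \<Rightarrow> real" and a b
  proof (rule integrable_bounded)
    show "\<bar>f x * g x\<bar> \<le> a * b" for x
      unfolding abs_mult using that by (intro mult_mono) (auto intro: order_trans[OF abs_ge_zero])
  qed (use that in auto)
  have int_t: "integrable M (truncate \<phi> t)"
    using trunc by (intro integrable_bounded[of _ t]) auto
  have int_G: "integrable M (G t)"
    using int_t by (simp add: G_def)
  have sq: "integrable M (\<lambda>x. (truncate \<phi> t x)\<^sup>2)" "integrable M (\<lambda>x. (truncate \<phi> u x)\<^sup>2)"
    "integrable M (\<lambda>x. (G t x)\<^sup>2)" "integrable M (\<lambda>x. (truncate \<phi> u ((T ^^ k) x))\<^sup>2)"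
    unfolding power2_eq_square using trunc G by (auto intro!: prod)
  have EG: "expectation (G t) = 0"
    using int_t by (simp add: G_def prob_space)
  \<comment> \<open>The left side is the variance of the truncation.\<close>
  have VG: "expectation (\<lambda>x. (G t x)\<^sup>2) \<le> V t"
    unfolding G_def V_def using int_t sq by (subst variance_eq) auto
  have small: "\<bar>expectation (\<lambda>x. truncate \<phi> u ((T ^^ k) x) * G t x)\<bar> \<le> (s * V u + V t / s) / 2"
  proof -
    have "\<bar>expectation (\<lambda>x. truncate \<phi> u ((T ^^ k) x) * G t x)\<bar>
        \<le> expectation (\<lambda>x. \<bar>truncate \<phi> u ((T ^^ k) x) * G t x\<bar>)"
      by (rule integral_abs_bound)
    also have "\<dots> \<le> expectation (\<lambda>x. (s * (truncate \<phi> u ((T ^^ k) x))\<^sup>2 + (G t x)\<^sup>2 / s) / 2)"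
      using sq trunc G s by (intro integral_mono abs_mult_le_weighted integrable_abs) (auto intro!: prod)
    also have "\<dots> = (s * expectation (\<lambda>x. (truncate \<phi> u ((T ^^ k) x))\<^sup>2)
        + expectation (\<lambda>x. (G t x)\<^sup>2) / s) / 2"
      using sq by simp
    also have "expectation (\<lambda>x. (truncate \<phi> u ((T ^^ k) x))\<^sup>2) = V u"
      unfolding V_def by (rule integral_measure_preserving[OF Tk]) simp
    also have "(s * V u + expectation (\<lambda>x. (G t x)\<^sup>2) / s) / 2 \<le> (s * V u + V t / s) / 2"
      using VG s by (simp add: divide_right_mono)
    finally show ?thesis .
  qed
  have large: "\<bar>expectation (\<lambda>x. D ((T ^^ k) x) * G t x)\<bar> \<le> B * V t / u"
  proof -
    let ?h = "(transfer_operator M T ^^ k) (G t)"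
    have int_h: "integrable M ?h"
      by (rule integrable_transfer_operator_funpow[OF T int_G])
    have Dh: "AE x in M. \<bar>D x * ?h x\<bar> \<le> B * ((truncate \<phi> t x)\<^sup>2 / u)"
      using B
    proof eventually_elim
      case (elim x)
      have "\<bar>D x\<bar> * \<bar>?h x\<bar> \<le> (truncate \<phi> t x)\<^sup>2 / u * B"
        unfolding D_def using elim u by (intro mult_mono abs_truncate_diff_le) auto
      then show ?case by (simp add: abs_mult mult_ac)
    qed
    have "expectation (\<lambda>x. D ((T ^^ k) x) * G t x) = expectation (\<lambda>x. D x * ?h x)"
      by (rule transfer_operator_funpow_dual[OF T int_G _ D]) simp
    also have "\<bar>\<dots>\<bar> \<le> expectation (\<lambda>x. \<bar>D x * ?h x\<bar>)"
      by (rule integral_abs_bound)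
    also have "\<dots> \<le> expectation (\<lambda>x. B * ((truncate \<phi> t x)\<^sup>2 / u))"
    proof (rule integral_mono_AE)
      have [measurable]: "?h \<in> borel_measurable M"
        using int_h by simp
      show int: "integrable M (\<lambda>x. B * ((truncate \<phi> t x)\<^sup>2 / u))"
        using sq by auto
      show "integrable M (\<lambda>x. \<bar>D x * ?h x\<bar>)"
      proof (rule Bochner_Integration.integrable_bound[OF int])
        show "AE x in M. norm \<bar>D x * ?h x\<bar> \<le> norm (B * ((truncate \<phi> t x)\<^sup>2 / u))"
          using Dh by eventually_elim (unfold real_norm_def abs_idempotent, erule order_trans[OF _ abs_ge_self])
      qed simp
    qed (fact Dh)
    also have "\<dots> = B * V t / u"
      by (simp add: V_def)
    finally show ?thesis .
  qed
  \<comment> \<open>The mean \<open>m\<close> in the composed factor contributes nothing because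
    \<open>G t\<close> integrates to 0.\<close>
  have "expectation (\<lambda>x. G t ((T ^^ k) x) * G t x)
      = expectation (\<lambda>x. truncate \<phi> u ((T ^^ k) x) * G t x + D ((T ^^ k) x) * G t x - m * G t x)"
    by (simp add: G_def D_def m_def algebra_simps)
  also have "\<dots> = expectation (\<lambda>x. truncate \<phi> u ((T ^^ k) x) * G t x)
      + expectation (\<lambda>x. D ((T ^^ k) x) * G t x) - expectation (\<lambda>x. m * G t x)"
  proof -
    have "integrable M (\<lambda>x. truncate \<phi> u ((T ^^ k) x) * G t x)"
      by (rule prod) (use trunc G in auto)
    moreover have "integrable M (\<lambda>x. D ((T ^^ k) x) * G t x)"
      by (rule prod) (use D G in auto)
    ultimately show ?thesis
      using int_G by simp
  qed
  also have "expectation (\<lambda>x. m * G t x) = 0"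
    using EG by simp
  finally show ?thesis
    using small large by linarith
qed

text \<open>Expand the square. By stationarity the correlation of times \<open>i\<close> and
  \<open>j\<close> depends only on \<open>|i - j|\<close>, so each row is dominated by two geometric
  series, one on each side of the diagonal.\<close>

lemma second_moment_birkhoff_sum_le:
  fixes G :: "'a \<Rightarrow> real"
  assumes T: "measure_preserving M T" and [measurable]: "G \<in> borel_measurable M"
    and C: "\<And>x. \<bar>G x\<bar> \<le> C"
    and decay: "\<And>k. \<bar>expectation (\<lambda>x. G ((T ^^ k) x) * G x)\<bar> \<le> A * q ^ k"
    and q: "0 \<le> q" "q < 1" and "A \<ge> 0"
  shows "expectation (\<lambda>x. (\<Sum>j=1..n. G ((T ^^ j) x))\<^sup>2) \<le> real n * (2 * A / (1 - q))"
proof -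
  have Tm: "measure_preserving M (T ^^ k)" for k
    by (rule measure_preserving_funpow[OF T])
  then have [measurable]: "(T ^^ k) \<in> M \<rightarrow>\<^sub>M M" for k
    by (simp add: measure_preserving_def)
  have le: "\<bar>expectation (\<lambda>x. G ((T ^^ i) x) * G ((T ^^ j) x))\<bar> \<le> A * q ^ (j - i)" if "i \<le> j" for i j
  proof -
    have "expectation (\<lambda>x. G ((T ^^ i) x) * G ((T ^^ j) x))
        = expectation (\<lambda>x. G ((T ^^ (j - i)) ((T ^^ i) x)) * G ((T ^^ i) x))"
    proof -
      have "(T ^^ j) x = (T ^^ (j - i)) ((T ^^ i) x)" for x
        using funpow_add[of "j - i" i T] that by simp
      then show ?thesis by (simp add: mult.commute)
    qed
    also have "\<dots> = expectation (\<lambda>x. G ((T ^^ (j - i)) x) * G x)"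
      by (rule integral_measure_preserving[OF Tm]) simp
    finally show ?thesis using decay by simp
  qed
  \<comment> \<open>The diagonal is counted in both summands, which is harmless since
    \<open>A \<ge> 0\<close>; the row then splits cleanly into two sums.\<close>
  have le': "expectation (\<lambda>x. G ((T ^^ i) x) * G ((T ^^ j) x))
      \<le> (if i \<le> j then A * q ^ (j - i) else 0) + (if j \<le> i then A * q ^ (i - j) else 0)" for i j
  proof (cases "i \<le> j")
    case True
    then show ?thesis using le[of i j] \<open>A \<ge> 0\<close> by auto
  next
    case False
    then show ?thesis using le[of j i] by (auto simp: mult.commute)
  qed
  have int: "integrable M (\<lambda>x. G ((T ^^ i) x) * G ((T ^^ j) x))" for i j
  proof (rule integrable_bounded)
    show "\<bar>G ((T ^^ i) x) * G ((T ^^ j) x)\<bar> \<le> C * C" for x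
      unfolding abs_mult using C by (intro mult_mono) (auto intro: order_trans[OF abs_ge_zero])
  qed simp
  have row: "(\<Sum>j=1..n. expectation (\<lambda>x. G ((T ^^ i) x) * G ((T ^^ j) x))) \<le> 2 * A / (1 - q)" for i
  proof -
    have "(\<Sum>j=1..n. expectation (\<lambda>x. G ((T ^^ i) x) * G ((T ^^ j) x)))
        \<le> (\<Sum>j=1..n. (if i \<le> j then A * q ^ (j - i) else 0) + (if j \<le> i then A * q ^ (i - j) else 0))"
      by (intro sum_mono le')
    also have "\<dots> = A * (\<Sum>j\<in>{j\<in>{1..n}. i \<le> j}. q ^ (j - i)) + A * (\<Sum>j\<in>{j\<in>{1..n}. j \<le> i}. q ^ (i - j))"
      by (simp only: sum.distrib sum_distrib_left sum.inter_filter[OF finite_atLeastAtMost]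
          if_distrib[where f = "(*) A"] mult_zero_right)
    also have "\<dots> \<le> A * (1 / (1 - q)) + A * (1 / (1 - q))"
      using q \<open>A \<ge> 0\<close> by (intro add_mono mult_left_mono sum_power_inj_le) (auto simp: inj_on_def)
    finally show ?thesis by simp
  qed
  have "expectation (\<lambda>x. (\<Sum>j=1..n. G ((T ^^ j) x))\<^sup>2)
      = (\<Sum>i=1..n. \<Sum>j=1..n. expectation (\<lambda>x. G ((T ^^ i) x) * G ((T ^^ j) x)))"
    using int by (simp add: power2_eq_square sum_product)
  also have "\<dots> \<le> (\<Sum>i=1..n. 2 * A / (1 - q))"
    by (intro sum_mono row)
  finally show ?thesis by simp
qed

end

section \<open>Correlation decay of truncations for Gibbs-Markov maps\<close>

context gibbs_markov
begin

lemma sets_eq_leb01: "sets \<mu> = sets leb01"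
  and AE_leb01_imp_AE: "(AE x in leb01. Q x) \<Longrightarrow> AE x in \<mu>. Q x"
proof -
  obtain h where [measurable]: "h \<in> borel_measurable leb01"
    and h: "\<mu> = density leb01 (\<lambda>x. ennreal (h x))"
    using density by blast
  show "sets \<mu> = sets leb01"
    using h by simp
  show "AE x in \<mu>. Q x" if "AE x in leb01. Q x"
    unfolding h using that by (subst AE_density) auto
qed

text \<open>BV dominates the essential supremum, and null sets of Lebesgue measure are null for
  \<mu>. So decay in BV becomes a pointwise bound almost everywhere.\<close>

lemma exponential_decay_AE_bound:
  assumes "exponential_decay_BV \<mu> T"
  shows "\<exists>C>0. \<exists>r\<in>{0<..<1}. \<forall>g\<in>borel_measurable \<mu>. integrable \<mu> g \<longrightarrow> (\<integral>x. g x \<partial>\<mu>) = 0 \<longrightarrow>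
    (\<forall>R>0. BV_norm g \<le> ennreal R \<longrightarrow>
      (\<forall>k. AE x in \<mu>. \<bar>(transfer_operator \<mu> T ^^ k) g x\<bar> \<le> C * r ^ k * R))"
proof -
  obtain C r where C: "C > 0" and r: "0 < r" "r < 1"
    and decay: "\<And>g k. g \<in> BV \<Longrightarrow> (\<integral>x. g x \<partial>\<mu>) = 0 \<Longrightarrow>
      BV_norm ((transfer_operator \<mu> T ^^ k) g) \<le> ennreal (C * r ^ k) * BV_norm g"
    using assms unfolding exponential_decay_BV_def by (metis greaterThanLessThan_iff)
  have meas_eq: "borel_measurable \<mu> = (borel_measurable leb01 :: (real \<Rightarrow> real) set)"
    by (rule measurable_cong_sets[OF sets_eq_leb01 refl])
  \<comment> \<open>The factor 2, with \<open>R > 0\<close>, provides the strict inequality that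
    \<open>AE_abs_le_BV_norm\<close> asks for.\<close>
  have "AE x in \<mu>. \<bar>(transfer_operator \<mu> T ^^ k) g x\<bar> \<le> 2 * C * r ^ k * R"
    if g: "g \<in> borel_measurable \<mu>" "integrable \<mu> g" "(\<integral>x. g x \<partial>\<mu>) = 0"
      and R: "R > 0" "BV_norm g \<le> ennreal R" for g k R
  proof (rule AE_leb01_imp_AE, rule AE_abs_le_BV_norm)
    show "(transfer_operator \<mu> T ^^ k) g \<in> borel_measurable leb01"
      using integrable_transfer_operator_funpow[OF preserving g(2), of k] meas_eq by auto
    have "BV_norm g < \<infinity>"
      using R(2) by (simp add: le_less_trans)
    then have "BV_norm ((transfer_operator \<mu> T ^^ k) g) \<le> ennreal (C * r ^ k) * BV_norm g"
      using g meas_eq by (intro decay) (auto simp: BV_def)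
    also have "\<dots> \<le> ennreal (C * r ^ k) * ennreal R"
      using R by (intro mult_left_mono) auto
    also have "\<dots> = ennreal (C * r ^ k * R)"
      using C r R by (simp add: ennreal_mult)
    also have "\<dots> < ennreal (2 * C * r ^ k * R)"
      using C r R by (intro ennreal_lessI) auto
    finally show "BV_norm ((transfer_operator \<mu> T ^^ k) g) < ennreal (2 * C * r ^ k * R)" .
  qed
  then show ?thesis
    using C r by (intro exI[of _ "2 * C"] conjI bexI[of _ r]) auto
qed

lemma truncated_correlation_decay:
  fixes \<phi> :: "real \<Rightarrow> real"
  defines "H \<equiv> \<lambda>x. measure \<mu> {y\<in>space \<mu>. \<bar>\<phi> y\<bar> > x}"
    and "G \<equiv> \<lambda>t x. truncate \<phi> t x - expectation (truncate \<phi> t)"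
  assumes exp_decay: "exponential_decay_BV \<mu> T" and \<alpha>: "0 < \<alpha>" "\<alpha> < 2"
    and \<phi> [measurable]: "\<phi> \<in> borel_measurable \<mu>"
    and dom: "stable_domain_of_attraction \<mu> \<alpha> \<phi>"
    and BV: "\<exists>K::real. \<forall>\<^sub>F t in at_top. BV_norm (truncate \<phi> t) \<le> ennreal (K * t)"
  shows "\<exists>A\<ge>0. \<exists>q\<in>{0<..<1}. \<exists>t\<^sub>1>0. \<forall>t\<ge>t\<^sub>1. \<forall>k.
    \<bar>expectation (\<lambda>x. G t ((T ^^ k) x) * G t x)\<bar> \<le> A * (t\<^sup>2 * H t) * q ^ k"
proof -
  have meas_eq: "borel_measurable \<mu> = (borel_measurable leb01 :: (real \<Rightarrow> real) set)"
    by (rule measurable_cong_sets[OF sets_eq_leb01 refl])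
  obtain C r where C: "C > 0" and r: "0 < r" "r < 1"
    and decay: "\<And>g R k. g \<in> borel_measurable \<mu> \<Longrightarrow> integrable \<mu> g \<Longrightarrow> (\<integral>x. g x \<partial>\<mu>) = 0 \<Longrightarrow> R > 0 \<Longrightarrow>
      BV_norm g \<le> ennreal R \<Longrightarrow> AE x in \<mu>. \<bar>(transfer_operator \<mu> T ^^ k) g x\<bar> \<le> C * r ^ k * R"
    using exponential_decay_AE_bound[OF exp_decay] by (metis greaterThanLessThan_iff)
  obtain K t\<^sub>K where K: "\<And>t. t \<ge> t\<^sub>K \<Longrightarrow> BV_norm (truncate \<phi> t) \<le> ennreal (K * t)"
    using BV by (auto simp: eventually_at_top_linorder)
  \<comment> \<open>With cut level \<open>u = \<rho>^k * t\<close>, the loss \<open>t / u\<close>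
    uses up one of the two factors \<open>\<rho>^k\<close> in \<open>r^k\<close>.\<close>
  define \<rho> where "\<rho> = sqrt r"
  have \<rho>: "0 < \<rho>" "\<rho> < 1" "\<rho> * \<rho> = r"
    using r by (auto simp: \<rho>_def)
  \<comment> \<open>Chosen so that \<open>\<tau>^2\<close> is the rate of
    \<open>truncated_moment_scaling\<close>; \<tau> is the final rate of decay and dominates
    \<rho>.\<close>
  define \<tau> where "\<tau> = \<rho> powr ((2 - \<alpha>) / 4)"
  have "\<tau> > 0" using \<rho> by (simp add: \<tau>_def)
  have "\<tau> < 1"
    using \<rho> \<alpha> powr_less_mono'[of \<rho> 0 "(2 - \<alpha>) / 4"] by (simp add: \<tau>_def)
  have "\<rho> powr 1 \<le> \<tau>"
    unfolding \<tau>_def using \<rho> \<alpha> by (intro powr_mono') auto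
  then have "\<rho> \<le> \<tau>" using \<rho> by simp
  have \<tau>2: "\<rho> powr ((2 - \<alpha>) / 2) = \<tau> * \<tau>"
    by (simp add: \<tau>_def flip: powr_add)
  define V where "V s = expectation (\<lambda>x. (truncate \<phi> s x)\<^sup>2)" for s
  obtain S t\<^sub>S where S: "S > 0" "t\<^sub>S > 0"
    and scaling: "\<And>t k. t \<ge> t\<^sub>S \<Longrightarrow> V (\<rho> ^ k * t) \<le> S * (\<tau> * \<tau>) ^ k * (t\<^sup>2 * H t)"
    using truncated_moment_scaling[OF \<phi> dom \<alpha> \<rho>(1,2)] unfolding \<tau>2 V_def H_def by blast
  \<comment> \<open>The truncation contributes \<open>K * t\<close>, with \<open>max\<close> in case
    \<open>K\<close> is negative, and the centring constant at most \<open>t\<close>.\<close>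
  define K' where "K' = max K 0 + 1"
  have "K' > 0" by (simp add: K'_def)
  define t\<^sub>1 where "t\<^sub>1 = max t\<^sub>S t\<^sub>K"
  define A where "A = S + C * K' * S"
  have "\<bar>expectation (\<lambda>x. G t ((T ^^ k) x) * G t x)\<bar> \<le> A * (t\<^sup>2 * H t) * \<tau> ^ k"
    if t: "t \<ge> t\<^sub>1" for t k
  proof -
    have t': "t \<ge> t\<^sub>S" "t \<ge> t\<^sub>K" using t by (auto simp: t\<^sub>1_def)
    have "t > 0" using t' S by simp
    define W where "W = t\<^sup>2 * H t"
    have "W \<ge> 0" by (simp add: W_def H_def)
    define m where "m = expectation (truncate \<phi> t)"
    have int: "integrable \<mu> (truncate \<phi> t)"
      using abs_truncate_le[OF \<open>t > 0\<close>] by (intro integrable_bounded) auto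
    have "\<bar>m\<bar> \<le> t"
    proof -
      have "\<bar>m\<bar> \<le> expectation (\<lambda>x. \<bar>truncate \<phi> t x\<bar>)"
        unfolding m_def by (rule integral_abs_bound)
      also have "\<dots> \<le> t"
        using int abs_truncate_le[OF \<open>t > 0\<close>, of \<phi>] by (intro integral_le_const) auto
      finally show ?thesis .
    qed
    have "BV_norm (G t) \<le> BV_norm (truncate \<phi> t) + ennreal \<bar>m\<bar>"
      unfolding G_def m_def by (rule BV_norm_diff_const) (simp flip: meas_eq)
    also have "\<dots> \<le> ennreal (max K 0 * t) + ennreal t"
      using K[OF t'(2)] \<open>\<bar>m\<bar> \<le> t\<close> \<open>t > 0\<close>
      by (intro add_mono ennreal_leI order_trans[OF K[OF t'(2)]] mult_right_mono) auto
    also have "\<dots> = ennreal (K' * t)"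
      using \<open>t > 0\<close> by (simp add: K'_def distrib_right flip: ennreal_plus)
    finally have AE: "AE x in \<mu>. \<bar>(transfer_operator \<mu> T ^^ k) (G t) x\<bar> \<le> C * r ^ k * (K' * t)"
      using int \<open>K' > 0\<close> \<open>t > 0\<close> by (intro decay) (auto simp: G_def prob_space)
    have "\<rho> ^ k \<le> 1" using \<rho> by (intro power_le_one) auto
    \<comment> \<open>The weight is \<open>s = 1 / \<tau>^k\<close>: as \<open>V u\<close> is of
      order \<open>\<tau>^(2k) * W\<close> and \<open>V t\<close> of order \<open>W\<close>, both
      terms of Young's inequality become of order \<open>\<tau>^k * W\<close>.\<close>
    have "\<bar>expectation (\<lambda>x. G t ((T ^^ k) x) * G t x)\<bar>
        \<le> ((1 / \<tau> ^ k) * V (\<rho> ^ k * t) + V t / (1 / \<tau> ^ k)) / 2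
          + C * r ^ k * (K' * t) * V t / (\<rho> ^ k * t)"
      unfolding V_def G_def
      by (rule correlation_split_bound[OF preserving \<phi>])
        (use \<rho> \<open>t > 0\<close> \<open>\<tau> > 0\<close> \<open>\<rho> ^ k \<le> 1\<close> AE in \<open>auto simp: G_def mult_left_le_one_le\<close>)
    also have "\<dots> = (V (\<rho> ^ k * t) / \<tau> ^ k + \<tau> ^ k * V t) / 2 + C * K' * \<rho> ^ k * V t"
      using \<open>t > 0\<close> \<rho>(1) by (simp add: power_mult_distrib flip: \<rho>(3))
    also have "\<dots> \<le> (S * \<tau> ^ k * W + \<tau> ^ k * (S * W)) / 2 + C * K' * \<tau> ^ k * (S * W)"
    proof -
      have "V (\<rho> ^ k * t) / \<tau> ^ k \<le> S * \<tau> ^ k * W"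
        using scaling[OF t'(1), of k] \<open>\<tau> > 0\<close> by (simp add: W_def field_simps power_mult_distrib)
      \<comment> \<open>The instance \<open>k = 0\<close> of the scaling bound controls the moment
        at level \<open>t\<close> itself.\<close>
      moreover have V: "V t \<le> S * W"
        using scaling[OF t'(1), of 0] by (simp add: W_def)
      moreover have "C * K' * \<rho> ^ k * V t \<le> C * K' * \<tau> ^ k * (S * W)"
        using C \<open>K' > 0\<close> \<open>\<rho> \<le> \<tau>\<close> \<open>\<tau> > 0\<close> \<rho> V
        by (intro mult_mono power_mono) (auto simp: V_def)
      ultimately show ?thesis
        using \<open>\<tau> > 0\<close> by (intro add_mono divide_right_mono mult_left_mono) auto
    qed
    also have "\<dots> = A * W * \<tau> ^ k"
      by (simp add: A_def algebra_simps)
    finally show ?thesis by (simp add: W_def)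
  qed
  moreover have "A \<ge> 0" "t\<^sub>1 > 0"
    using S C \<open>K' > 0\<close> by (auto simp: A_def t\<^sub>1_def)
  ultimately show ?thesis
    using \<open>\<tau> > 0\<close> \<open>\<tau> < 1\<close> by (intro exI[of _ A] conjI bexI[of _ \<tau>] exI[of _ t\<^sub>1]) auto
qed

end

subsection \<open>Small jumps\<close>

text \<open>Dividing by \<open>n\<close> shows that \<open>H (b n)\<close> tends to 0; since
  \<open>H\<close> is positive and decreasing, \<open>b n\<close> must eventually pass every level
  \<open>Z\<close>.\<close>

lemma filterlim_normalising_sequence:
  fixes H :: "real \<Rightarrow> real"
  assumes "antimono H" and H_pos: "\<And>x. H x > 0"
    and "(\<lambda>n. real n * H (b n)) \<longlonglongrightarrow> 1"
  shows "filterlim b at_top sequentially"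
  unfolding filterlim_at_top
proof
  fix Z
  have "(\<lambda>n. (real n * H (b n)) * (1 / real n)) \<longlonglongrightarrow> 1 * 0"
    by (intro tendsto_mult assms lim_1_over_n)
  then have "\<forall>\<^sub>F n in sequentially. real n * H (b n) * (1 / real n) < H Z"
    using H_pos[of Z] by (intro order_tendstoD(2)) auto
  then show "\<forall>\<^sub>F n in sequentially. Z \<le> b n"
    \<comment> \<open>At \<open>n = 0\<close> the product vanishes because \<open>1 / 0 = 0\<close>,
      so \<open>n\<close> cancels only for positive \<open>n\<close>.\<close>
    using eventually_gt_at_top[of 0]
  proof eventually_elim
    case (elim n)
    then have "H (b n) < H Z" by simp
    then show ?case
      using antimonoD[OF \<open>antimono H\<close>, of "b n" Z] by linarith
  qed
qed

theorem theorem8p1: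
  fixes \<mu> :: "real measure" and T :: "real \<Rightarrow> real" and P :: "real set set"
    and \<alpha> :: real and \<phi> :: "real \<Rightarrow> real" and b :: "nat \<Rightarrow> real"
  assumes "gibbs_markov \<mu> T P"
    and "exponential_decay_BV \<mu> T"
    and "1 < \<alpha>" and "\<alpha> < 2"
    and "\<phi> \<in> borel_measurable \<mu>"
    and "stable_domain_of_attraction \<mu> \<alpha> \<phi>"
    and "\<exists>K::real. \<forall>\<^sub>F t in at_top. BV_norm (truncate \<phi> t) \<le> ennreal (K * t)"
    and "\<And>n. n \<ge> 1 \<Longrightarrow> b n > 0"
    and "(\<lambda>n. real n * measure \<mu> {x\<in>space \<mu>. \<bar>\<phi> x\<bar> > b n}) \<longlonglongrightarrow> 1"
  shows "\<forall>\<delta>>0. ((\<lambda>\<epsilon>. limsup (\<lambda>n. emeasure \<mu> {x\<in>space \<mu>.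
      \<bar>1 / b n * (\<Sum>j=1..n. truncate \<phi> (b n * \<epsilon>) ((T ^^ j) x))
       - 1 / b n * (\<integral>y. (\<Sum>j=1..n. truncate \<phi> (b n * \<epsilon>) ((T ^^ j) y)) \<partial>\<mu>)\<bar> > \<delta>}))
    \<longlongrightarrow> 0) (at_right 0)"
proof (intro allI impI)
  fix \<delta> :: real assume "\<delta> > 0"
  interpret gibbs_markov \<mu> T P by fact
  note \<phi> [measurable] = assms(5) and dom = assms(6)
  define H where "H x = measure \<mu> {y\<in>space \<mu>. \<bar>\<phi> y\<bar> > x}" for x
  define G where "G t x = truncate \<phi> t x - expectation (truncate \<phi> t)" for t x
  obtain A q t\<^sub>1 where A: "A \<ge> 0" and q: "0 < q" "q < 1" and "t\<^sub>1 > 0"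
    and decay: "\<And>t k. t \<ge> t\<^sub>1 \<Longrightarrow>
      \<bar>expectation (\<lambda>x. G t ((T ^^ k) x) * G t x)\<bar> \<le> A * (t\<^sup>2 * H t) * q ^ k"
    using truncated_correlation_decay[OF assms(2) _ assms(4-7)] assms(3)
    unfolding G_def H_def by (auto simp del: One_nat_def)
  have H_pos: "H x > 0" for x
    unfolding H_def by (rule tail_pos[OF \<phi> dom])
  have "antimono H"
    unfolding H_def by (intro antimonoI finite_measure_mono) auto
  have b_lim: "filterlim b at_top sequentially"
    using filterlim_normalising_sequence[OF \<open>antimono H\<close> H_pos] assms(9) by (simp add: H_def)
  \<comment> \<open>The second moment bound divided by \<open>(\<delta> * b n)^2\<close>: with
    \<open>t = \<epsilon> * b n\<close> the factor \<open>(b n)^2\<close> cancels, and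
    \<open>\<epsilon>^2\<close> is split off from \<open>D\<close>.\<close>
  define D where "D = 2 * A / (1 - q) / \<delta>\<^sup>2"
  have "D \<ge> 0" using A q by (simp add: D_def)
  define E where "E \<epsilon> n = emeasure \<mu> {x\<in>space \<mu>.
      \<bar>1 / b n * (\<Sum>j=1..n. truncate \<phi> (b n * \<epsilon>) ((T ^^ j) x))
       - 1 / b n * (\<integral>y. (\<Sum>j=1..n. truncate \<phi> (b n * \<epsilon>) ((T ^^ j) y)) \<partial>\<mu>)\<bar> > \<delta>}" for \<epsilon> n
  have Tm: "measure_preserving \<mu> (T ^^ k)" for k
    by (rule measure_preserving_funpow[OF preserving])
  then have [measurable]: "(T ^^ k) \<in> \<mu> \<rightarrow>\<^sub>M \<mu>" for k
    by (simp add: measure_preserving_def)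
  have chebyshev: "E \<epsilon> n \<le> ennreal (D * \<epsilon>\<^sup>2 * (real n * H (\<epsilon> * b n)))"
    if "n \<ge> 1" "\<epsilon> > 0" "t\<^sub>1 \<le> \<epsilon> * b n" for \<epsilon> n
  proof -
    define t where "t = \<epsilon> * b n"
    have "b n > 0" using assms(8) that by simp
    then have "t > 0" using that by (simp add: t_def)
    define m where "m = expectation (truncate \<phi> t)"
    define S where "S x = (\<Sum>j=1..n. G t ((T ^^ j) x))" for x
    have G_meas [measurable]: "G t \<in> borel_measurable \<mu>"
      unfolding G_def[abs_def] by measurable
    have [measurable]: "S \<in> borel_measurable \<mu>"
      unfolding S_def[abs_def] by measurable
    have G_bound: "\<bar>G t x\<bar> \<le> t + \<bar>m\<bar>" for x
      using abs_truncate_le[OF \<open>t > 0\<close>, of \<phi> x] by (simp add: G_def m_def)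
    have S_bound: "\<bar>S x\<bar> \<le> real n * (t + \<bar>m\<bar>)" for x
    proof -
      have "\<bar>S x\<bar> \<le> (\<Sum>j=1..n. \<bar>G t ((T ^^ j) x)\<bar>)"
        unfolding S_def by (rule sum_abs)
      also have "\<dots> \<le> (\<Sum>j=1..n. t + \<bar>m\<bar>)"
        by (intro sum_mono G_bound)
      finally show ?thesis by simp
    qed
    have S2: "integrable \<mu> (\<lambda>x. (S x)\<^sup>2)"
    proof (rule integrable_bounded)
      show "\<bar>(S x)\<^sup>2\<bar> \<le> (real n * (t + \<bar>m\<bar>))\<^sup>2" for x
        using power_mono[OF S_bound[of x], of 2] by simp
    qed simp
    have "(\<integral>y. (\<Sum>j=1..n. truncate \<phi> t ((T ^^ j) y)) \<partial>\<mu>)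
        = (\<Sum>j=1..n. (\<integral>y. truncate \<phi> t ((T ^^ j) y) \<partial>\<mu>))"
      using abs_truncate_le[OF \<open>t > 0\<close>, of \<phi>]
      by (intro Bochner_Integration.integral_sum integrable_bounded[of _ t]) auto
    also have "\<dots> = (\<Sum>j=1..n. m)"
      unfolding m_def by (intro sum.cong refl integral_measure_preserving[OF Tm]) simp
    finally have mean: "(\<integral>y. (\<Sum>j=1..n. truncate \<phi> t ((T ^^ j) y)) \<partial>\<mu>) = (\<Sum>j=1..n. m)" .
    \<comment> \<open>By invariance every summand has mean \<open>m\<close>, so centring the sum
      amounts to centring each term.\<close>
    have S_eq: "1 / b n * (\<Sum>j=1..n. truncate \<phi> t ((T ^^ j) x))
        - 1 / b n * (\<integral>y. (\<Sum>j=1..n. truncate \<phi> t ((T ^^ j) y)) \<partial>\<mu>) = S x / b n" for x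
      unfolding mean S_def G_def m_def[symmetric] sum_subtractf by (simp add: diff_divide_distrib)
    have "E \<epsilon> n = emeasure \<mu> {x\<in>space \<mu>. \<bar>S x / b n\<bar> > \<delta>}"
      unfolding E_def S_eq[symmetric] by (simp add: t_def mult.commute)
    also have "\<dots> \<le> emeasure \<mu> {x\<in>space \<mu>. (\<delta> * b n)\<^sup>2 \<le> (S x)\<^sup>2}"
    proof (rule emeasure_mono)
      show "{x\<in>space \<mu>. \<bar>S x / b n\<bar> > \<delta>} \<subseteq> {x\<in>space \<mu>. (\<delta> * b n)\<^sup>2 \<le> (S x)\<^sup>2}"
      proof safe
        fix x assume "\<delta> < \<bar>S x / b n\<bar>"
        then have "\<bar>\<delta> * b n\<bar> \<le> \<bar>S x\<bar>"
          using \<open>b n > 0\<close> \<open>\<delta> > 0\<close> by (simp add: abs_mult field_simps)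
        then show "(\<delta> * b n)\<^sup>2 \<le> (S x)\<^sup>2"
          by (simp add: abs_le_square_iff)
      qed
    qed measurable
    also have "\<dots> \<le> ennreal (expectation (\<lambda>x. (S x)\<^sup>2) / (\<delta> * b n)\<^sup>2)"
      unfolding emeasure_eq_measure using \<open>b n > 0\<close> \<open>\<delta> > 0\<close> S2
      by (intro ennreal_leI integral_Markov_inequality_measure[where A = "{}"]) auto
    also have "\<dots> \<le> ennreal (D * \<epsilon>\<^sup>2 * (real n * H (\<epsilon> * b n)))"
    proof (rule ennreal_leI)
      have "expectation (\<lambda>x. (S x)\<^sup>2) \<le> real n * (2 * (A * (t\<^sup>2 * H t)) / (1 - q))"
        unfolding S_def
      proof (rule second_moment_birkhoff_sum_le[OF preserving G_meas G_bound])
        show "\<bar>expectation (\<lambda>x. G t ((T ^^ k) x) * G t x)\<bar> \<le> A * (t\<^sup>2 * H t) * q ^ k" for k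
          by (rule decay) (simp add: t_def that)
      qed (use A q H_pos[of t] in auto)
      then have "expectation (\<lambda>x. (S x)\<^sup>2) / (\<delta> * b n)\<^sup>2
          \<le> real n * (2 * (A * (t\<^sup>2 * H t)) / (1 - q)) / (\<delta> * b n)\<^sup>2"
        by (rule divide_right_mono) simp
      also have "\<dots> = D * \<epsilon>\<^sup>2 * (real n * H (\<epsilon> * b n))"
        using \<open>b n > 0\<close> by (simp add: D_def t_def power_mult_distrib)
      finally show "expectation (\<lambda>x. (S x)\<^sup>2) / (\<delta> * b n)\<^sup>2 \<le> D * \<epsilon>\<^sup>2 * (real n * H (\<epsilon> * b n))" .
    qed
    finally show ?thesis .
  qed
  \<comment> \<open>Write \<open>n * H (\<epsilon> * b n)\<close> as \<open>n * H (b n)\<close>,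
    which tends to 1, times a tail ratio with limit
    \<open>\<epsilon> powr (-\<alpha>)\<close>.\<close>
  have limsup_le: "limsup (E \<epsilon>) \<le> ennreal (D * \<epsilon> powr (2 - \<alpha>))" if "\<epsilon> > 0" for \<epsilon>
  proof -
    have "(\<lambda>n. H (\<epsilon> * b n) / H (b n)) \<longlonglongrightarrow> \<epsilon> powr (-\<alpha>)"
      using filterlim_compose[OF tail_ratio_tendsto[OF dom that] b_lim] by (simp add: H_def)
    then have "(\<lambda>n. (real n * H (b n)) * (H (\<epsilon> * b n) / H (b n))) \<longlonglongrightarrow> 1 * \<epsilon> powr (-\<alpha>)"
      by (intro tendsto_mult) (use assms(9) in \<open>simp add: H_def\<close>)
    then have "(\<lambda>n. real n * H (\<epsilon> * b n)) \<longlonglongrightarrow> \<epsilon> powr (-\<alpha>)"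
      using H_pos by (simp add: less_imp_neq[THEN not_sym])
    then have "(\<lambda>n. ennreal (D * \<epsilon>\<^sup>2 * (real n * H (\<epsilon> * b n))))
        \<longlonglongrightarrow> ennreal (D * \<epsilon>\<^sup>2 * \<epsilon> powr (-\<alpha>))"
      by (intro tendsto_intros)
    moreover have "\<epsilon>\<^sup>2 * \<epsilon> powr (-\<alpha>) = \<epsilon> powr (2 - \<alpha>)"
      using that powr_add[of \<epsilon> 2 "-\<alpha>"] by simp
    ultimately have lim: "limsup (\<lambda>n. ennreal (D * \<epsilon>\<^sup>2 * (real n * H (\<epsilon> * b n))))
        = ennreal (D * \<epsilon> powr (2 - \<alpha>))"
      by (intro lim_imp_Limsup) (simp_all add: mult.assoc)
    \<comment> \<open>For fixed \<epsilon> the truncation level \<open>\<epsilon> * b n\<close>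
      eventually exceeds the threshold \<open>t\<^sub>1\<close> from which decay is known.\<close>
    have "\<forall>\<^sub>F n in sequentially. t\<^sub>1 / \<epsilon> \<le> b n"
      using b_lim by (simp add: filterlim_at_top)
    then have "\<forall>\<^sub>F n in sequentially. E \<epsilon> n \<le> ennreal (D * \<epsilon>\<^sup>2 * (real n * H (\<epsilon> * b n)))"
      using eventually_ge_at_top[of 1]
      by eventually_elim (rule chebyshev, use that in \<open>simp_all add: pos_divide_le_eq mult.commute\<close>)
    then show ?thesis
      unfolding lim[symmetric] by (rule Limsup_mono)
  qed
  \<comment> \<open>The exponent is positive because \<open>\<alpha> < 2\<close>, and
    \<open>0 powr (2 - \<alpha>)\<close> is 0.\<close>
  have "((\<lambda>\<epsilon>. ennreal (D * \<epsilon> powr (2 - \<alpha>))) \<longlongrightarrow> ennreal (D * 0 powr (2 - \<alpha>))) (at_right 0)"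
    using assms(4) by (intro tendsto_intros tendsto_powr') (auto intro: eventually_mono[OF eventually_at_right_less])
  then have upper: "((\<lambda>\<epsilon>. ennreal (D * \<epsilon> powr (2 - \<alpha>))) \<longlongrightarrow> 0) (at_right 0)"
    by simp
  have "((\<lambda>\<epsilon>. limsup (E \<epsilon>)) \<longlongrightarrow> 0) (at_right 0)"
  proof (rule tendsto_sandwich[OF _ _ tendsto_const upper])
    show "\<forall>\<^sub>F \<epsilon> in at_right 0. limsup (E \<epsilon>) \<le> ennreal (D * \<epsilon> powr (2 - \<alpha>))"
      using eventually_at_right_less[of 0] by eventually_elim (rule limsup_le)
  qed simp
  then show "((\<lambda>\<epsilon>. limsup (\<lambda>n. emeasure \<mu> {x\<in>space \<mu>.
      \<bar>1 / b n * (\<Sum>j=1..n. truncate \<phi> (b n * \<epsilon>) ((T ^^ j) x))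
       - 1 / b n * (\<integral>y. (\<Sum>j=1..n. truncate \<phi> (b n * \<epsilon>) ((T ^^ j) y)) \<partial>\<mu>)\<bar> > \<delta>}))
    \<longlongrightarrow> 0) (at_right 0)"
    unfolding E_def .
qed

end
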